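(* Let $\mathsf{n}$ be a cyclic tuple of linear subspaces of a finite-dimensional vector space $V$ over a field $\mathbb{K}$. Then every basis of the Minkowski matroid $\mathsf{M}(\mathsf{n})$ is a BK-tuple.
   Context: A tuple is a finite indexed family of linear subspaces of $V$ (repetitions allowed); a subtuple is a subfamily indexed by a subset of the index set. For a tuple $\mathsf{k}$, $\langle\mathsf{k}\rangle=\sum_{L\in\mathsf{k}}L$ (zero for the empty tuple), $\mathfrak{c}(\mathsf{k})$ is the number of its entries, and $\delta(\mathsf{k})=\dim\langle\mathsf{k}\rangle-\mathfrak{c}(\mathsf{k})$ is its defect. A tuple is linearly independent if every subtuple (including itself) has non-negative defect. A BK-tuple is a linearly independent tuple with defect $0$. The Minkowski matroid $\mathsf{M}(\mathsf{n})$ has ground set the entries (indices) of $\mathsf{n}$ and independent sets the linearly independent subtuples; bases are maximal independent subtuples and circuits are minimal linearly dependent subtuples. A tuple $\mathsf{n}$ is cyclic if it is a union of circuits of its own Minkowski matroid $\mathsf{M}(\mathsf{n})$. *)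

theory Defs
  imports Complex_Main
begin

text \<open>
  A tuple is given by an index set \<open>I\<close> and a family \<open>n\<close> of subspaces; the values of \<open>n\<close> outside \<open>I\<close>
  are irrelevant. Its subtuples are the restrictions to \<open>J \<subseteq> I\<close>. All cardinalities and sums below
  are meant for finite index sets.

  The scalar multiplication \<open>scale\<close> is an explicit parameter rather than fixed by the locale
  \<^locale>\<open>vector_space\<close>, because the global interpretation of that locale for real vector
  spaces would shadow the new constants.
\<close>

type_synonym 'i set_system = "'i set \<times> 'i set set"  \<comment> \<open>ground set and independent sets\<close>

definition matroid_bases :: "'i set_system \<Rightarrow> 'i set set" where
  "matroid_bases M = {B \<in> snd M. \<forall>B' \<in> snd M. B \<subseteq> B' \<longrightarrow> B' = B}"

definition matroid_circuits :: "'i set_system \<Rightarrow> 'i set set" where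
  "matroid_circuits M = {C. C \<subseteq> fst M \<and> C \<notin> snd M \<and> (\<forall>C'. C' \<subset> C \<longrightarrow> C' \<in> snd M)}"

definition tuple_sum :: "'i set \<Rightarrow> ('i \<Rightarrow> 'v::ab_group_add set) \<Rightarrow> 'v set" where
  "tuple_sum I n = {\<Sum>i\<in>I. v i | v. \<forall>i\<in>I. v i \<in> n i}"

definition tuple_defect ::
    "('k::field \<Rightarrow> 'v::ab_group_add \<Rightarrow> 'v) \<Rightarrow> 'i set \<Rightarrow> ('i \<Rightarrow> 'v set) \<Rightarrow> int" where
  "tuple_defect scale I n = int (vector_space.dim scale (tuple_sum I n)) - int (card I)"

definition lin_indep_tuple ::
    "('k::field \<Rightarrow> 'v::ab_group_add \<Rightarrow> 'v) \<Rightarrow> 'i set \<Rightarrow> ('i \<Rightarrow> 'v set) \<Rightarrow> bool" where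
  "lin_indep_tuple scale I n \<longleftrightarrow> (\<forall>J. J \<subseteq> I \<longrightarrow> tuple_defect scale J n \<ge> 0)"

definition BK_tuple ::
    "('k::field \<Rightarrow> 'v::ab_group_add \<Rightarrow> 'v) \<Rightarrow> 'i set \<Rightarrow> ('i \<Rightarrow> 'v set) \<Rightarrow> bool" where
  "BK_tuple scale I n \<longleftrightarrow> lin_indep_tuple scale I n \<and> tuple_defect scale I n = 0"

definition minkowski_matroid ::
    "('k::field \<Rightarrow> 'v::ab_group_add \<Rightarrow> 'v) \<Rightarrow> 'i set \<Rightarrow> ('i \<Rightarrow> 'v set) \<Rightarrow> 'i set_system" where
  "minkowski_matroid scale I n = (I, {J. J \<subseteq> I \<and> lin_indep_tuple scale J n})"

definition cyclic_tuple ::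
    "('k::field \<Rightarrow> 'v::ab_group_add \<Rightarrow> 'v) \<Rightarrow> 'i set \<Rightarrow> ('i \<Rightarrow> 'v set) \<Rightarrow> bool" where
  "cyclic_tuple scale I n \<longleftrightarrow>
    (\<exists>\<C> \<subseteq> matroid_circuits (minkowski_matroid scale I n). I = \<Union>\<C>)"

end

theory Submission
  imports Defs
begin

text \<open>
  The function \<open>J \<mapsto> dim \<langle>J\<rangle>\<close> is submodular, so the tight (defect 0) subsets of the basis \<open>B\<close> are
  closed under union. Let \<open>T\<close> be the largest one. Maximality of \<open>B\<close> puts every space outside \<open>B\<close>
  inside \<open>\<langle>T\<rangle>\<close>. If some \<open>b \<in> B - T\<close> existed, take a circuit \<open>C\<close> through \<open>b\<close> and put
  \<open>S = T \<union> (I - B)\<close>, so that \<open>\<langle>S\<rangle> = \<langle>T\<rangle>\<close>. As \<open>C \<inter> S\<close> is independent, submodularity gives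
  \<open>dim \<langle>C \<union> S\<rangle> < |C| + |T| - |C \<inter> S| = |T \<union> (C - S)|\<close>, whereas \<open>\<langle>C \<union> S\<rangle> = \<langle>T \<union> (C - S)\<rangle>\<close> is
  spanned by a subtuple of \<open>B\<close>.
\<close>

context finite_dimensional_vector_space
begin

text \<open>As \<open>dim\<close> sees a set only through its span, this lets all later arguments
  work with plain unions of the spaces instead of sums.\<close>

lemma tuple_sum_eq_span:
  assumes "finite J" "\<And>i. i \<in> J \<Longrightarrow> subspace (n i)"
  shows "tuple_sum J n = span (\<Union>i\<in>J. n i)"
  using assms
proof (induction J)
  case empty
  then show ?case by (simp add: tuple_sum_def)
next
  case (insert j J)
  have "tuple_sum (insert j J) n = {x + y | x y. x \<in> n j \<and> y \<in> tuple_sum J n}" (is "_ = ?R")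
  proof (intro subset_antisym subsetI)
    fix z assume "z \<in> tuple_sum (insert j J) n"
    then show "z \<in> ?R"
      using insert.hyps by (auto simp: tuple_sum_def)
  next
    fix z assume "z \<in> ?R"
    then obtain x v where x: "x \<in> n j" and v: "\<forall>i\<in>J. v i \<in> n i" and z: "z = x + (\<Sum>i\<in>J. v i)"
      by (auto simp: tuple_sum_def)
    have "(\<Sum>i\<in>J. (v(j := x)) i) = (\<Sum>i\<in>J. v i)"
      using insert.hyps by (intro sum.cong) auto
    then have "z = (\<Sum>i\<in>insert j J. (v(j := x)) i)"
      using z insert.hyps by simp
    then show "z \<in> tuple_sum (insert j J) n"
      using x v unfolding tuple_sum_def by (intro CollectI exI[of _ "v(j := x)"]) auto
  qed
  also have "\<dots> = {x + y | x y. x \<in> span (n j) \<and> y \<in> span (\<Union>i\<in>J. n i)}"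
    using insert by (simp add: span_eq_iff[THEN iffD2])
  also have "\<dots> = span (\<Union>i\<in>insert j J. n i)"
    by (auto simp: span_Un)
  finally show ?case .
qed

lemma tuple_defect_eq:
  assumes "finite J" "\<And>i. i \<in> J \<Longrightarrow> subspace (n i)"
  shows "tuple_defect scale J n = int (dim (\<Union>i\<in>J. n i)) - int (card J)"
  using assms by (simp add: tuple_defect_def tuple_sum_eq_span dim_span)

text \<open>This is the dimension formula for \<open>span A\<close> and \<open>span B\<close>.
  Equality may fail for arbitrary sets because \<open>A \<inter> B\<close> need not span
  \<open>span A \<inter> span B\<close>.\<close>

lemma dim_Un_Int_le: "dim (A \<union> B) + dim (A \<inter> B) \<le> dim A + dim B"
proof -
  have "dim (A \<inter> B) \<le> dim (span A \<inter> span B)"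
    by (intro dim_subset) (auto intro: span_base)
  moreover have "dim {x + y | x y. x \<in> span A \<and> y \<in> span B} + dim (span A \<inter> span B) = dim A + dim B"
    by (simp add: dim_sums_Int subspace_span dim_span)
  moreover have "dim {x + y | x y. x \<in> span A \<and> y \<in> span B} = dim (A \<union> B)"
    by (metis span_Un dim_span)
  ultimately show ?thesis by linarith
qed

lemma dim_UNION_submodular:
  "dim (\<Union>i\<in>J \<union> K. n i) + dim (\<Union>i\<in>J \<inter> K. n i) \<le> dim (\<Union>i\<in>J. n i) + dim (\<Union>i\<in>K. n i)"
proof -
  have "dim (\<Union>i\<in>J \<inter> K. n i) \<le> dim ((\<Union>i\<in>J. n i) \<inter> (\<Union>i\<in>K. n i))"
    by (intro dim_subset) auto
  then show ?thesis
    using dim_Un_Int_le[of "\<Union>i\<in>J. n i" "\<Union>i\<in>K. n i"] by (simp add: UN_Un)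
qed

lemma lin_indep_tuple_iff:
  assumes "finite J" "\<And>i. i \<in> J \<Longrightarrow> subspace (n i)"
  shows "lin_indep_tuple scale J n \<longleftrightarrow> (\<forall>K\<subseteq>J. card K \<le> dim (\<Union>i\<in>K. n i))"
proof -
  have "tuple_defect scale K n = int (dim (\<Union>i\<in>K. n i)) - int (card K)" if "K \<subseteq> J" for K
    using that assms by (intro tuple_defect_eq) (auto intro: finite_subset)
  then show ?thesis by (auto simp: lin_indep_tuple_def)
qed

lemma largest_tight_subtuple:
  assumes fin: "finite B"
    and indep: "\<And>K. K \<subseteq> B \<Longrightarrow> card K \<le> dim (\<Union>i\<in>K. n i)"
  obtains T where "T \<subseteq> B" "dim (\<Union>i\<in>T. n i) = card T"
    "\<And>K. K \<subseteq> B \<Longrightarrow> dim (\<Union>i\<in>K. n i) = card K \<Longrightarrow> K \<subseteq> T"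
proof -
  define \<T> where "\<T> = {K. K \<subseteq> B \<and> dim (\<Union>i\<in>K. n i) = card K}"
  \<comment> \<open>Independence bounds the dimensions for \<open>K \<union> L\<close> and
    \<open>K \<inter> L\<close> from below, submodularity bounds their sum from above by
    \<open>card K + card L\<close>, so both bounds are attained.\<close>
  have Un: "K \<union> L \<in> \<T>" if "K \<in> \<T>" "L \<in> \<T>" for K L
  proof -
    have KL: "K \<subseteq> B" "L \<subseteq> B" "finite K" "finite L"
      using that fin by (auto simp: \<T>_def intro: finite_subset)
    have "card (K \<union> L) \<le> dim (\<Union>i\<in>K \<union> L. n i)" "card (K \<inter> L) \<le> dim (\<Union>i\<in>K \<inter> L. n i)"
      using KL by (auto intro!: indep simp del: UN_Un)
    with dim_UNION_submodular[where J = K and K = L and n = n] card_Un_Int[OF KL(3,4)] that KL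
    show ?thesis by (simp add: \<T>_def del: UN_Un)
  qed
  have "{} \<in> \<T>" using indep[of "{}"] by (simp add: \<T>_def)
  moreover have "finite \<T>" using fin by (simp add: \<T>_def)
  ultimately obtain T where T: "T \<in> \<T>" "\<And>K. K \<in> \<T> \<Longrightarrow> T \<subseteq> K \<Longrightarrow> T = K"
    using finite_has_maximal[of \<T>] by blast
  have "K \<subseteq> T" if "K \<in> \<T>" for K
    using T(2)[OF Un[OF T(1) that]] by auto
  with T(1) that show thesis by (auto simp: \<T>_def)
qed

text \<open>Adding \<open>e\<close> raises the cardinality by one and cannot lower the dimension, so
  \<open>card T \<le> dim ?A \<le> dim ?B < card T + 1\<close> forces equality throughout the first
  two steps.\<close>

lemma subset_span_if_not_indep_insert:
  assumes fin: "finite T" and indep: "card T \<le> dim (\<Union>i\<in>T. n i)" and e: "e \<notin> T"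
    and dep: "dim (\<Union>i\<in>insert e T. n i) < card (insert e T)"
  shows "dim (\<Union>i\<in>T. n i) = card T" "n e \<subseteq> span (\<Union>i\<in>T. n i)"
proof -
  let ?A = "\<Union>i\<in>T. n i" and ?B = "\<Union>i\<in>insert e T. n i"
  have "dim ?A \<le> dim ?B" by (intro dim_subset) auto
  with fin indep e dep show "dim ?A = card T" by simp
  with fin e dep have "dim ?B \<le> dim ?A" by simp
  then have "span ?A = span ?B"
    by (intro dim_eq_span) auto
  then show "n e \<subseteq> span ?A" by (auto intro: span_base)
qed

lemma BK_tuple_basis_of_cyclic:
  assumes fin: "finite I"
    and sub: "\<And>i. i \<in> I \<Longrightarrow> subspace (n i)"
    and cyc: "cyclic_tuple scale I n"
    and basis: "B \<in> matroid_bases (minkowski_matroid scale I n)"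
  shows "BK_tuple scale B n"
proof -
  define d where "d J = dim (\<Union>i\<in>J. n i)" for J
  have indep_iff: "lin_indep_tuple scale J n \<longleftrightarrow> (\<forall>K\<subseteq>J. card K \<le> d K)" if "J \<subseteq> I" for J
    unfolding d_def using that sub by (intro lin_indep_tuple_iff finite_subset[OF that fin]) auto
  have BI: "B \<subseteq> I" and B_lin: "lin_indep_tuple scale B n"
    and B_max: "\<And>J. J \<subseteq> I \<Longrightarrow> lin_indep_tuple scale J n \<Longrightarrow> B \<subseteq> J \<Longrightarrow> J = B"
    using basis by (auto simp: matroid_bases_def minkowski_matroid_def)
  have B_indep: "card K \<le> d K" if "K \<subseteq> B" for K
    using B_lin that indep_iff[OF BI] by auto
  have finB: "finite B" using BI fin by (rule finite_subset)
  obtain T where TB: "T \<subseteq> B" and dT: "d T = card T"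
    and T_max: "\<And>K. K \<subseteq> B \<Longrightarrow> d K = card K \<Longrightarrow> K \<subseteq> T"
    using largest_tight_subtuple[OF finB, of n] B_indep unfolding d_def by metis
  have outside: "n e \<subseteq> span (\<Union>i\<in>T. n i)" if e: "e \<in> I - B" for e
  proof -
    have "\<not> lin_indep_tuple scale (insert e B) n"
      using B_max[of "insert e B"] e BI by auto
    then obtain K where K: "K \<subseteq> insert e B" "d K < card K"
      using indep_iff[of "insert e B"] e BI by (auto simp: not_le)
    then have eK: "e \<in> K" using B_indep[of K] by (meson not_le subset_insert)
    let ?K = "K - {e}"
    have KB: "?K \<subseteq> B" using K by auto
    have "finite ?K" "card ?K \<le> dim (\<Union>i\<in>?K. n i)" "e \<notin> ?K"
      "dim (\<Union>i\<in>insert e ?K. n i) < card (insert e ?K)"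
      using finite_subset[OF KB finB] B_indep[OF KB] K(2) insert_Diff[OF eK]
      unfolding d_def by (auto simp del: UN_insert UN_simps)
    note tight = subset_span_if_not_indep_insert[OF this]
    \<comment> \<open>The tight set depends on \<open>e\<close>; that \<open>T\<close> is the
      largest one makes it serve all \<open>e\<close> at once.\<close>
    have "?K \<subseteq> T" using T_max[OF KB] tight(1) by (simp add: d_def)
    then have "span (\<Union>i\<in>?K. n i) \<subseteq> span (\<Union>i\<in>T. n i)" by (intro span_mono) auto
    with tight(2) show ?thesis by blast
  qed
  have "b \<in> T" if bB: "b \<in> B" for b
  proof (rule ccontr)
    assume bT: "b \<notin> T"
    obtain C where C: "C \<in> matroid_circuits (minkowski_matroid scale I n)" and bC: "b \<in> C"
      using cyc bB BI unfolding cyclic_tuple_def by blast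
    have CI: "C \<subseteq> I" and C_dep: "\<not> lin_indep_tuple scale C n"
      and C_min: "\<And>K. K \<subset> C \<Longrightarrow> lin_indep_tuple scale K n"
      using C by (auto simp: matroid_circuits_def minkowski_matroid_def)
    have proper: "card K \<le> d K" if "K \<subset> C" for K
      using C_min[OF that] indep_iff[of K] that CI by auto
    \<comment> \<open>Only \<open>C\<close> itself can violate the inequality, by
      minimality.\<close>
    then have dC: "d C < card C"
      using C_dep indep_iff[OF CI] by (metis not_le psubsetI)
    have finC: "finite C" using CI fin by (rule finite_subset)
    define S where "S = T \<union> (I - B)"
    have span_S: "(\<Union>i\<in>S. n i) \<subseteq> span (\<Union>i\<in>T. n i)"
      using outside by (auto simp: S_def intro: span_base)
    have "d S \<le> card T"
      using dim_subset[OF span_S] dT by (simp add: d_def dim_span)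
    \<comment> \<open>The element \<open>b\<close> lies in \<open>C\<close> but not in
      \<open>S\<close>, so \<open>C \<inter> S\<close> is a proper subset of the circuit.\<close>
    moreover have "card (C \<inter> S) \<le> d (C \<inter> S)"
      using bC bT bB by (intro proper) (auto simp: S_def)
    moreover have "d (C \<union> S) + d (C \<inter> S) \<le> d C + d S"
      unfolding d_def by (rule dim_UNION_submodular)
    \<comment> \<open>Since \<open>S\<close> contains both \<open>T\<close> and
      \<open>I - B\<close>, the set \<open>C - S\<close> lies in \<open>B\<close> and is disjoint
      from \<open>T\<close>.\<close>
    moreover have "card T + card (C - S) \<le> d (C \<union> S)"
    proof -
      have "card T + card (C - S) = card (T \<union> (C - S))"
        using TB finB finC by (intro card_Un_disjoint[symmetric]) (auto simp: S_def intro: finite_subset)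
      also have "\<dots> \<le> d (T \<union> (C - S))"
        using TB CI by (intro B_indep) (auto simp: S_def)
      also have "\<dots> \<le> d (C \<union> S)"
        unfolding d_def by (intro dim_subset) (auto simp: S_def)
      finally show ?thesis .
    qed
    moreover have "card C = card (C \<inter> S) + card (C - S)"
      using finC by (metis card_Diff_subset_Int card_mono inf_le1 le_add_diff_inverse finite_Int)
    ultimately show False using dC by linarith
  qed
  then have "d B = card B" using TB dT by (metis subset_antisym subsetI)
  moreover have "tuple_defect scale B n = int (d B) - int (card B)"
    unfolding d_def using BI sub by (intro tuple_defect_eq finB) auto
  ultimately show ?thesis using B_lin by (simp add: BK_tuple_def)
qed

end

theorem theorem2p4:
  fixes scale :: "'k::field \<Rightarrow> 'v::ab_group_add \<Rightarrow> 'v"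
    and Basis :: "'v set"
    and I :: "'i set"
    and n :: "'i \<Rightarrow> 'v set"
  assumes "finite_dimensional_vector_space scale Basis"
    and "finite I"
    and "\<And>i. i \<in> I \<Longrightarrow> module.subspace scale (n i)"
    and "cyclic_tuple scale I n"
    and "B \<in> matroid_bases (minkowski_matroid scale I n)"
  shows "BK_tuple scale B n"
  using assms by (rule finite_dimensional_vector_space.BK_tuple_basis_of_cyclic)

end
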